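(* Consider an MTDC system with line resistances $\gamma R_{ij}$, $(i,j)\in\mathcal{E}$, $\gamma>0$, controlled by the decentralized PI controller with deadband $$u_i=-K_i^P(V_i-V_i^{\text{nom}})-K_i^Iz_i,\qquad \dot z_i=[V_i-\overline{V}_i]^+-[\underline{V}_i-V_i]^+,\qquad i\in\mathcal{V},$$ with gains $K_i^P>0$, $K_i^I>0$ and voltage bounds satisfying $\underline{V}_i\le V_i^{\text{nom}}\le\overline{V}_i$ for all $i\in\mathcal{V}$. If $\|I^{\text{inj}}\|$ is sufficiently small and the line resistances go to zero, then the controlled system satisfies the current-sharing objective, with cost matrix $F=\operatorname{diag}(f_1,\dots,f_n)$ given by $F^{-1}=\operatorname{diag}(K_1^P,\dots,K_n^P)$, if the initial voltage $V(0)$ is very close to $V^{\text{nom}}$. That is, there exists $\delta>0$ such that for every constant $I^{\text{inj}}\in\mathbb{R}^n$ with $\|I^{\text{inj}}\|<\delta$ and every closed-loop solution with $\|V(0)-V^{\text{nom}}\|<\delta$, denoting by $u^\gamma(t)$ the controlled injected currents along the solution with scaling $\gamma$, $$\lim_{\gamma\to0^+}\ \lim_{t\to\infty}u^\gamma(t)=u^*,$$ where $u^*$ is the optimal current injection for $f_i=1/K_i^P$.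
   Context: MTDC (multi-terminal high-voltage direct current) system: let $\mathcal{G}$ be a fixed, undirected, connected graph with vertex set $\mathcal{V}=\{1,\dots,n\}$ (terminals) and edge set $\mathcal{E}$ (lines); the neighbours of $i$ are $\mathcal{N}_i$. Each edge $(i,j)$ has a base resistance $R_{ij}=R_{ji}>0$ and each terminal has capacitance $C_i>0$. With resistances $\gamma R_{ij}$ the terminal voltages $V=[V_1,\dots,V_n]^T$ obey $C_i\dot V_i=-\sum_{j\in\mathcal{N}_i}\frac{1}{\gamma R_{ij}}(V_i-V_j)+I_i^{\text{inj}}+u_i$ for $i\in\mathcal{V}$, where $I_i^{\text{inj}}$ is an unknown, constant uncontrolled injected current, $I^{\text{inj}}=[I_1^{\text{inj}},\dots,I_n^{\text{inj}}]^T$, and $u_i$ is the controlled injected current, $u=[u_1,\dots,u_n]^T$. The scalar $z_i$ is the integrator state of the controller at terminal $i$, $[x]^+=\max(x,0)$, and $\underline{V}_i,\overline{V}_i$ are the lower and upper limits of the acceptable operating range of terminal $i$. $\mathcal{L}_R$ is the weighted graph Laplacian with edge weights $1/R_{ij}$, so that $\gamma^{-1}\mathcal{L}_R$ is the Laplacian of the scaled system. The nominal voltages are equal: $V_i^{\text{nom}}=V_j^{\text{nom}}$ for all $i,j\in\mathcal{V}$, and $V^{\text{nom}}=[V_1^{\text{nom}},\dots,V_n^{\text{nom}}]^T$. Current-sharing objective with cost coefficients $f_i>0$: the controlled currents satisfy $\lim_{t\to\infty}u(t)=u^*$, where $u^*$ is the (unique) $u$-component of a minimizer $[u^*,V^*]$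 of $\sum_{i\in\mathcal{V}}\frac12f_iu_i^2$ over $[u,V]\in\mathbb{R}^n\times\mathbb{R}^n$ subject to $\gamma^{-1}\mathcal{L}_RV=I^{\text{inj}}+u$. The vector $u^*$ does not depend on $\gamma>0$, since the factor $\gamma^{-1}$ can be absorbed into $V$.
   Formalization: The voltage bounds are assumed strict (lower limit < nominal < upper limit at every terminal) and the integrator states start at zero, z(0)=0; with non-strict bounds or arbitrary z(0) the claim is false. *)

theory Defs
  imports "HOL-Analysis.Analysis"
begin

text \<open>The terminals are the elements of a finite type \<open>'n\<close>, and the lines form a symmetric
  relation \<open>E\<close> on it. Every undirected line thus appears in \<open>E\<close> in both orientations.\<close>

definition nbrs :: "('n \<times> 'n) set \<Rightarrow> 'n \<Rightarrow> 'n set" where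
  "nbrs E i = {j. (i, j) \<in> E}"

definition connected_graph :: "('n \<times> 'n) set \<Rightarrow> bool" where
  "connected_graph E \<longleftrightarrow> sym E \<and> irrefl E \<and> (\<forall>i j. (i, j) \<in> E\<^sup>*)"

definition laplacian :: "('n::finite \<times> 'n) set \<Rightarrow> ('n \<Rightarrow> 'n \<Rightarrow> real) \<Rightarrow> real ^ 'n ^ 'n" where
  "laplacian E R =
     (\<chi> i j. if i = j then (\<Sum>k\<in>nbrs E i. 1 / R i k)
             else if j \<in> nbrs E i then - (1 / R i j) else 0)"

definition pos_part :: "real \<Rightarrow> real" where
  "pos_part x = max x 0"

text \<open>At \<open>t = 0\<close> the derivatives below are one-sided, since a trajectory is only constrained on
  \<open>[0, \<infinity>)\<close>.\<close>

definition mtdc_dynamics ::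
  "('n::finite \<times> 'n) set \<Rightarrow> ('n \<Rightarrow> 'n \<Rightarrow> real) \<Rightarrow> real ^ 'n \<Rightarrow> real \<Rightarrow> real ^ 'n
    \<Rightarrow> (real \<Rightarrow> real ^ 'n) \<Rightarrow> (real \<Rightarrow> real ^ 'n) \<Rightarrow> bool" where
  "mtdc_dynamics E R C \<gamma> Iinj u V \<longleftrightarrow>
     (\<forall>t\<ge>0. \<forall>i. ((\<lambda>s. V s $ i) has_real_derivative
        (- (\<Sum>j\<in>nbrs E i. 1 / (\<gamma> * R i j) * (V t $ i - V t $ j)) + Iinj $ i + u t $ i) / C $ i)
        (at t within {0..}))"

text \<open>Each integrator is at rest exactly while its voltage lies in \<open>[Vlo i, Vhi i]\<close>. If \<open>Vlo i = Vhi i\<close>,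
  the deadband is a single point and the controller is an ordinary PI controller, whose
  steady-state currents need not be optimal. A nonzero value \<open>z 0\<close> acts, while the integrators are
  at rest, like an additional constant injected current \<open>- KI i * z 0 i\<close>.\<close>

definition deadband_integrator ::
  "real ^ 'n \<Rightarrow> real ^ 'n \<Rightarrow> (real \<Rightarrow> real ^ 'n::finite) \<Rightarrow> (real \<Rightarrow> real ^ 'n) \<Rightarrow> bool" where
  "deadband_integrator Vlo Vhi V z \<longleftrightarrow>
     (\<forall>t\<ge>0. \<forall>i. ((\<lambda>s. z s $ i) has_real_derivative
        pos_part (V t $ i - Vhi $ i) - pos_part (Vlo $ i - V t $ i)) (at t within {0..}))"

definition pi_control ::
  "real ^ 'n \<Rightarrow> real ^ 'n \<Rightarrow> real ^ 'n \<Rightarrow> real ^ 'n \<Rightarrow> real ^ 'n \<Rightarrow> real ^ 'n::finite" where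
  "pi_control KP KI Vnom v z = (\<chi> i. - KP $ i * (v $ i - Vnom $ i) - KI $ i * z $ i)"

definition closed_loop_solution ::
  "('n::finite \<times> 'n) set \<Rightarrow> ('n \<Rightarrow> 'n \<Rightarrow> real) \<Rightarrow> real ^ 'n \<Rightarrow> real ^ 'n \<Rightarrow> real ^ 'n
    \<Rightarrow> real ^ 'n \<Rightarrow> real ^ 'n \<Rightarrow> real ^ 'n \<Rightarrow> real \<Rightarrow> real ^ 'n
    \<Rightarrow> (real \<Rightarrow> real ^ 'n) \<Rightarrow> (real \<Rightarrow> real ^ 'n) \<Rightarrow> bool" where
  "closed_loop_solution E R C KP KI Vnom Vlo Vhi \<gamma> Iinj V z \<longleftrightarrow>
     mtdc_dynamics E R C \<gamma> Iinj (\<lambda>t. pi_control KP KI Vnom (V t) (z t)) V \<and>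
     deadband_integrator Vlo Vhi V z"

definition optimal_injection ::
  "('n::finite \<times> 'n) set \<Rightarrow> ('n \<Rightarrow> 'n \<Rightarrow> real) \<Rightarrow> real \<Rightarrow> real ^ 'n \<Rightarrow> real ^ 'n \<Rightarrow> real ^ 'n \<Rightarrow> bool"
where
  "optimal_injection E R \<gamma> f Iinj us \<longleftrightarrow>
     (\<exists>Vs. is_arg_min (\<lambda>(u, V). \<Sum>i\<in>UNIV. 1 / 2 * f $ i * (u $ i)\<^sup>2)
            (\<lambda>(u, V). (1 / \<gamma>) *\<^sub>R (laplacian E R *v V) = Iinj + u) (us, Vs))"

end

theory Submission
  imports Defs
begin

text \<open>
  Let \<open>x = V - Vnom\<close>. Equal nominal voltages lie in the kernel of the Laplacian \<open>L\<close>, so as long as the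
  integrators are at rest at \<open>0\<close> the closed loop is the linear system
  \<open>C x' = Iinj - A x\<close> with \<open>A = L / \<gamma> + diag KP\<close>, the operator \<open>damped_laplacian\<close> below.
  Everything rests on the coercivity \<open>x \<bullet> A x \<ge> \<Sum> KP i * (x i)\<^sup>2\<close>, whose constants do not depend
  on \<open>\<gamma>\<close> because \<open>L\<close> is positive semidefinite. It has three consequences.

  First, \<open>A\<close> is invertible with inverse bounded by \<open>1 / min KP\<close>, so the equilibrium \<open>x\<^sub>\<gamma>\<close> solving
  \<open>A x = Iinj\<close> is small, uniformly in \<open>\<gamma>\<close>, when \<open>Iinj\<close> is. Secondly, the energy
  \<open>S = \<Sum> C i * ((x - x\<^sub>\<gamma>) i)\<^sup>2\<close> decays exponentially while the voltages are in the deadband. Below a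
  certain energy level they are in the deadband, and a decreasing energy never reaches that
  level again: a trajectory that starts close enough to \<open>Vnom\<close> never wakes an integrator
  (\<open>barrier_exponential_decay\<close>, \<open>closed_loop_settles_in_deadband\<close>), and the currents converge to
  \<open>- KP i * x\<^sub>\<gamma> i\<close>.

  Thirdly, let \<open>k = (\<Sum> Iinj) / (\<Sum> KP)\<close>, and let \<open>w\<close> satisfy \<open>L w = Iinj - k KP\<close>; it exists because on
  a connected graph the range of \<open>L\<close> consists of all vectors with zero sum. Then
  \<open>A (k 1 + \<gamma> w) = Iinj + O(\<gamma>)\<close>, so \<open>x\<^sub>\<gamma> = k 1 + O(\<gamma>)\<close>: as the resistances vanish, all voltage
  deviations tend to the common value \<open>k\<close> (\<open>damped_equilibrium_tendsto_consensus\<close>). The limiting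
  currents \<open>- k * KP i\<close> are the optimal ones, since feasibility of \<open>u\<close> only says \<open>\<Sum> u = - \<Sum> Iinj\<close>,
  and under this constraint \<open>\<Sum> (u i)\<^sup>2 / KP i\<close> is minimal exactly when \<open>u i / KP i\<close> does not depend
  on \<open>i\<close> (\<open>optimal_injection_iff\<close>).
\<close>

section \<open>Preliminaries from linear algebra and calculus\<close>

lemma linear_kernel_0_solvable:
  fixes f :: "real ^ 'n \<Rightarrow> real ^ 'n::finite"
  assumes "linear f" and "\<And>v. f v = 0 \<Longrightarrow> v = 0"
  obtains v where "f v = r"
proof -
  have "surj f"
    using assms linear_injective_imp_surjective linear_injective_0 by blast
  then show thesis using that by (metis surjD)
qed

lemma pos_lower_bound_finite:
  fixes g :: "'n::finite \<Rightarrow> real"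
  assumes "\<And>i. g i > 0"
  obtains m where "m > 0" and "\<And>i. m \<le> g i"
proof
  show "Min (range g) > 0" using assms by (subst Min_gr_iff) auto
  show "\<And>i. Min (range g) \<le> g i" by simp
qed

text \<open>A barrier argument: the differential inequality is only known up to the first time at which \<open>S\<close>
  reaches \<open>b\<close>. Up to that time it makes \<open>S\<close> nonincreasing, so \<open>b\<close> would have to be at most \<open>S 0\<close>;
  hence the level is never reached and the inequality holds forever. The hypothesis \<open>decay\<close> asks
  for the bound on all of \<open>[0, t]\<close> because the state of an integrator at time \<open>t\<close> depends on the whole
  past.\<close>

lemma barrier_exponential_decay:
  fixes S D :: "real \<Rightarrow> real"
  assumes deriv: "\<And>t. t \<ge> 0 \<Longrightarrow> (S has_real_derivative D t) (at t within {0..})"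
    and nonneg: "\<And>t. S t \<ge> 0" and "a \<ge> 0" and init: "S 0 < b"
    and decay: "\<And>t. t \<ge> 0 \<Longrightarrow> (\<And>s. 0 \<le> s \<Longrightarrow> s \<le> t \<Longrightarrow> S s < b) \<Longrightarrow> D t \<le> - a * S t"
    and t: "t \<ge> 0"
  shows "S t < b" and "S t \<le> S 0 * exp (- a * t)"
proof -
  have cont: "continuous_on {0..} S"
    by (rule DERIV_continuous_on[of _ _ D]) (use deriv in auto)
  have deriv': "(S has_real_derivative D t) (at t)" if "t > 0" for t
  proof -
    have "at t within {0..} = at t"
      by (rule at_within_interior) (use that in \<open>simp add: interior_real_atLeast\<close>)
    then show ?thesis
      using deriv[of t] that by simp
  qed
  have below: "S t < b" if "t \<ge> 0" for t
  proof (rule ccontr)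
    assume "\<not> S t < b"
    define A where "A = {s \<in> {0..t}. b \<le> S s}"
    have "continuous_on {0..t} S"
      by (rule continuous_on_subset[OF cont]) auto
    then have "closed A"
      unfolding A_def by (intro continuous_on_closed_Collect_le continuous_on_const) auto
    moreover have "t \<in> A" and bdd: "bdd_below A"
      using that \<open>\<not> S t < b\<close> by (auto simp: A_def)
    ultimately have "Inf A \<in> A"
      using closed_contains_Inf by blast
    define \<tau> where "\<tau> = Inf A"
    have \<tau>: "0 \<le> \<tau>" "\<tau> \<le> t" and \<tau>b: "b \<le> S \<tau>"
      using \<open>Inf A \<in> A\<close> by (simp_all add: \<tau>_def[symmetric]) (simp_all add: A_def)
    then have \<tau>0: "\<tau> > 0"
      using init by (cases "\<tau> = 0") auto
    have before: "S s < b" if "0 \<le> s" "s < \<tau>" for s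
    proof (rule ccontr)
      assume "\<not> S s < b"
      then have "s \<in> A"
        using that \<tau> by (simp add: A_def)
      then show False
        using that cInf_lower[OF _ bdd, of s] by (simp add: \<tau>_def)
    qed
    have "S \<tau> \<le> S 0"
    proof (rule DERIV_nonpos_imp_decreasing_open[of 0 \<tau> S])
      show "\<exists>y. DERIV S s :> y \<and> y \<le> 0" if "0 < s" "s < \<tau>" for s
      proof (intro exI[of _ "D s"] conjI)
        show "DERIV S s :> D s" using that by (intro deriv')
        have "D s \<le> - a * S s"
          using that before by (intro decay) auto
        also have "\<dots> \<le> 0"
          using \<open>a \<ge> 0\<close> nonneg[of s] by simp
        finally show "D s \<le> 0" .
      qed
    qed (use \<tau>0 in \<open>auto intro: continuous_on_subset[OF cont]\<close>)
    then show False
      using init \<tau>b by simp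
  qed
  show "S t < b" using t by (rule below)
  \<comment> \<open>the integrating factor turns \<open>S' \<le> - a * S\<close> into monotonicity\<close>
  have "exp (a * t) * S t \<le> exp (a * 0) * S 0"
  proof (rule DERIV_nonpos_imp_decreasing_open[of 0 t "\<lambda>s. exp (a * s) * S s"])
    show "\<exists>y. DERIV (\<lambda>s. exp (a * s) * S s) s :> y \<and> y \<le> 0" if "0 < s" "s < t" for s
    proof (intro exI[of _ "exp (a * s) * (D s + a * S s)"] conjI)
      show "DERIV (\<lambda>s. exp (a * s) * S s) s :> exp (a * s) * (D s + a * S s)"
        using that
        by (auto intro!: derivative_eq_intros deriv' simp: algebra_simps)
      have "D s \<le> - a * S s"
        using that below by (intro decay) auto
      then show "exp (a * s) * (D s + a * S s) \<le> 0"
        by (simp add: mult_le_0_iff)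
    qed
    show "continuous_on {0..t} (\<lambda>s. exp (a * s) * S s)"
      using continuous_on_subset[OF cont, of "{0..t}"] by (intro continuous_intros) auto
  qed (use t in auto)
  then show "S t \<le> S 0 * exp (- a * t)"
    by (simp add: exp_minus field_simps)
qed

section \<open>The Laplacian of a connected resistive network\<close>

locale resistive_network =
  fixes E :: "('n::finite \<times> 'n) set" and R :: "'n \<Rightarrow> 'n \<Rightarrow> real"
  assumes connected: "connected_graph E"
    and resistance: "\<And>i j. (i, j) \<in> E \<Longrightarrow> R i j > 0 \<and> R i j = R j i"
begin

lemma laplacian_component:
  "(laplacian E R *v v) $ i = (\<Sum>j\<in>nbrs E i. (v $ i - v $ j) / R i j)"
proof -
  have i: "i \<notin> nbrs E i"
    using connected by (auto simp: connected_graph_def irrefl_def nbrs_def)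
  have "(laplacian E R *v v) $ i
      = (\<Sum>k\<in>nbrs E i. 1 / R i k) * v $ i
        + (\<Sum>j\<in>UNIV - {i}. if j \<in> nbrs E i then - (1 / R i j) * v $ j else 0)"
    unfolding matrix_vector_mult_def laplacian_def
    by (simp add: sum.remove[of UNIV i] cong: if_cong)
       (intro sum.cong, auto)
  also have "(\<Sum>j\<in>UNIV - {i}. if j \<in> nbrs E i then - (1 / R i j) * v $ j else 0)
      = (\<Sum>j\<in>nbrs E i. - (1 / R i j) * v $ j)"
    using i by (intro sum.mono_neutral_cong_right) auto
  also have "(\<Sum>k\<in>nbrs E i. 1 / R i k) * v $ i + \<dots>
      = (\<Sum>j\<in>nbrs E i. (v $ i - v $ j) / R i j)"
    by (simp add: sum_distrib_right sum.distrib[symmetric] diff_divide_distrib sum_subtractf sum_negf)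
  finally show ?thesis .
qed

text \<open>Every line occurs in \<open>E\<close> in both orientations, so a sum over lines may be taken with each
  line reversed. Both the vanishing column sums and the symmetric form of the quadratic form below
  come from this.\<close>

lemma sum_over_reversed_lines:
  fixes g :: "'n \<Rightarrow> 'n \<Rightarrow> real"
  shows "(\<Sum>i\<in>UNIV. \<Sum>j\<in>nbrs E i. g i j) = (\<Sum>i\<in>UNIV. \<Sum>j\<in>nbrs E i. g j i)"
proof -
  have nbrs_swap: "j \<in> nbrs E i \<longleftrightarrow> i \<in> nbrs E j" for i j
    using connected by (auto simp: connected_graph_def nbrs_def dest: symD)
  have "(\<Sum>i\<in>UNIV. \<Sum>j\<in>nbrs E i. g i j)
      = (\<Sum>i\<in>UNIV. \<Sum>j\<in>UNIV. if j \<in> nbrs E i then g i j else 0)"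
    by (simp add: sum.If_cases)
  also have "\<dots> = (\<Sum>j\<in>UNIV. \<Sum>i\<in>UNIV. if j \<in> nbrs E i then g i j else 0)"
    by (rule sum.swap)
  also have "\<dots> = (\<Sum>j\<in>UNIV. \<Sum>i\<in>UNIV. if i \<in> nbrs E j then g i j else 0)"
    by (simp add: nbrs_swap cong: if_cong)
  also have "\<dots> = (\<Sum>j\<in>UNIV. \<Sum>i\<in>nbrs E j. g i j)"
    by (simp add: sum.If_cases)
  finally show ?thesis .
qed

lemma resistance_commute: "j \<in> nbrs E i \<Longrightarrow> R j i = R i j"
  using resistance by (metis mem_Collect_eq nbrs_def)

lemma laplacian_sum_eq_0: "(\<Sum>i\<in>UNIV. (laplacian E R *v v) $ i) = 0"
proof -
  let ?g = "\<lambda>i j. (v $ i - v $ j) / R i j"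
  have "(\<Sum>i\<in>UNIV. \<Sum>j\<in>nbrs E i. ?g i j) = (\<Sum>i\<in>UNIV. \<Sum>j\<in>nbrs E i. - ?g i j)"
    unfolding sum_over_reversed_lines[of ?g]
    by (intro sum.cong refl) (simp add: resistance_commute minus_divide_left)
  then show ?thesis
    by (simp add: laplacian_component sum_negf)
qed

lemma laplacian_quadratic_form:
  "v \<bullet> (laplacian E R *v v)
     = 1 / 2 * (\<Sum>i\<in>UNIV. \<Sum>j\<in>nbrs E i. (v $ i - v $ j)\<^sup>2 / R i j)"
proof -
  let ?g = "\<lambda>i j. v $ i * ((v $ i - v $ j) / R i j)"
  have q: "v \<bullet> (laplacian E R *v v) = (\<Sum>i\<in>UNIV. \<Sum>j\<in>nbrs E i. ?g i j)"
    by (simp add: inner_vec_def laplacian_component sum_distrib_left)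
  then have "2 * (v \<bullet> (laplacian E R *v v))
      = (\<Sum>i\<in>UNIV. \<Sum>j\<in>nbrs E i. ?g i j) + (\<Sum>i\<in>UNIV. \<Sum>j\<in>nbrs E i. ?g j i)"
    using sum_over_reversed_lines[of ?g] by simp
  also have "\<dots> = (\<Sum>i\<in>UNIV. \<Sum>j\<in>nbrs E i. (v $ i - v $ j)\<^sup>2 / R i j)"
    unfolding sum.distrib[symmetric]
    by (intro sum.cong refl)
       (simp add: resistance_commute add_divide_distrib[symmetric] power2_eq_square algebra_simps)
  finally show ?thesis by simp
qed

lemma laplacian_nonneg: "v \<bullet> (laplacian E R *v v) \<ge> 0"
  unfolding laplacian_quadratic_form
  using resistance by (auto intro!: sum_nonneg divide_nonneg_pos simp: nbrs_def)

text \<open>A vanishing sum of the nonnegative terms \<open>(v i - v j)\<^sup>2 / R i j\<close> makes \<open>v\<close> agree at the two ends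
  of every line, hence along every path.\<close>

lemma quadratic_form_0_imp_constant:
  assumes "v \<bullet> (laplacian E R *v v) = 0"
  shows "v $ i = v $ j"
proof -
  have pos: "0 < R a b" if "b \<in> nbrs E a" for a b
    using resistance that by (auto simp: nbrs_def)
  have "(\<Sum>i\<in>UNIV. \<Sum>j\<in>nbrs E i. (v $ i - v $ j)\<^sup>2 / R i j) = 0"
    using assms by (simp add: laplacian_quadratic_form)
  then have "(\<Sum>j\<in>nbrs E a. (v $ a - v $ j)\<^sup>2 / R a j) = 0" for a
    by (subst (asm) sum_nonneg_eq_0_iff)
       (auto intro!: sum_nonneg divide_nonneg_pos pos)
  then have "(v $ a - v $ b)\<^sup>2 / R a b = 0" if "b \<in> nbrs E a" for a b
    using that by (subst (asm) sum_nonneg_eq_0_iff) (auto intro!: divide_nonneg_pos pos)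
  then have edge: "v $ a = v $ b" if "(a, b) \<in> E" for a b
    using that pos[of b a] by (fastforce simp: nbrs_def)
  have "(i, j) \<in> E\<^sup>*"
    using connected by (simp add: connected_graph_def)
  then show ?thesis
    by induction (auto dest: edge)
qed

lemma laplacian_const: "laplacian E R *v (\<chi> i. c) = 0"
  by (simp add: vec_eq_iff laplacian_component)

text \<open>Adding the matrix of ones to the Laplacian removes its kernel, the constant vectors: a vector in
  the kernel of the sum \<open>f\<close> has coordinate sum \<open>0\<close>, because the Laplacian contributes nothing to that
  sum, and is then constant. So \<open>f w = r\<close> is solvable, and for \<open>r\<close> with zero sum the
  extra term vanishes at the solution.\<close>

lemma laplacian_solvable:
  assumes "(\<Sum>i\<in>UNIV. r $ i) = 0"
  obtains w where "laplacian E R *v w = r"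
proof -
  define f where "f v = laplacian E R *v v + (\<chi> i. \<Sum>k\<in>UNIV. v $ k)" for v :: "real ^ 'n"
  have lin: "linear f"
    unfolding f_def
    by (intro linear_compose_add linear_compose matrix_vector_mul_linear linearI)
       (simp_all add: vec_eq_iff sum.distrib sum_distrib_left)
  have sum_f: "(\<Sum>i\<in>UNIV. f v $ i) = real CARD('n) * (\<Sum>k\<in>UNIV. v $ k)" for v
    by (simp add: f_def sum.distrib laplacian_sum_eq_0)
  have ker: "v = 0" if "f v = 0" for v
  proof -
    have s: "(\<Sum>k\<in>UNIV. v $ k) = 0"
      using sum_f[of v] that by simp
    then have "laplacian E R *v v = 0"
      using that by (simp add: f_def vec_eq_iff)
    then have const: "v $ i = v $ j" for i j
      using quadratic_form_0_imp_constant[of v i j] by simp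
    have "v $ i = 0" for i
    proof -
      have "(\<Sum>k\<in>UNIV. v $ k) = (\<Sum>k\<in>(UNIV::'n set). v $ i)"
        by (intro sum.cong refl const)
      then show ?thesis using s by simp
    qed
    then show ?thesis by (simp add: vec_eq_iff)
  qed
  obtain w where w: "f w = r"
    using linear_kernel_0_solvable[OF lin ker] by blast
  then have "(\<Sum>k\<in>UNIV. w $ k) = 0"
    using sum_f[of w] assms by simp
  then have "laplacian E R *v w = r"
    using w by (simp add: f_def vec_eq_iff)
  then show thesis by (rule that)
qed

end

section \<open>Static equilibria and their limit for vanishing resistance\<close>

definition damped_laplacian ::
  "('n::finite \<times> 'n) set \<Rightarrow> ('n \<Rightarrow> 'n \<Rightarrow> real) \<Rightarrow> real ^ 'n \<Rightarrow> real \<Rightarrow> real ^ 'n \<Rightarrow> real ^ 'n" where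
  "damped_laplacian E R K \<gamma> v = (1 / \<gamma>) *\<^sub>R (laplacian E R *v v) + (\<chi> i. K $ i * v $ i)"

lemma linear_damped_laplacian: "linear (damped_laplacian E R K \<gamma>)"
  unfolding damped_laplacian_def
  by (intro linearI) (simp_all add: vec_eq_iff matrix_vector_right_distrib 
     matrix_vector_mult_scaleR algebra_simps)

context resistive_network
begin

lemma damped_laplacian_coercive:
  assumes "\<gamma> > 0"
  shows "(\<Sum>i\<in>UNIV. K $ i * (v $ i)\<^sup>2) \<le> v \<bullet> damped_laplacian E R K \<gamma> v"
proof -
  have "v \<bullet> damped_laplacian E R K \<gamma> v
      = (1 / \<gamma>) * (v \<bullet> (laplacian E R *v v)) + (\<Sum>i\<in>UNIV. K $ i * (v $ i)\<^sup>2)"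
    unfolding damped_laplacian_def inner_add_right inner_scaleR_right
    by (simp add: inner_vec_def power2_eq_square ac_simps)
  then show ?thesis
    using laplacian_nonneg[of v] assms by simp
qed

text \<open>Coercivity and the Cauchy-Schwarz inequality. The absence of \<open>\<gamma>\<close> from the bound is what makes
  \<open>\<delta>\<close> independent of the resistance scaling in the final theorem.\<close>

lemma damped_laplacian_norm_bound:
  assumes "\<gamma> > 0" and "m > 0" and "\<And>i. m \<le> K $ i"
  shows "norm v \<le> norm (damped_laplacian E R K \<gamma> v) / m"
proof -
  have "m * (norm v * norm v) = (\<Sum>i\<in>UNIV. m * (v $ i)\<^sup>2)"
    by (simp flip: power2_eq_square add: power2_norm_eq_inner)
       (simp add: inner_vec_def sum_distrib_left power2_eq_square)
  also have "\<dots> \<le> (\<Sum>i\<in>UNIV. K $ i * (v $ i)\<^sup>2)"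
    by (intro sum_mono mult_right_mono assms) auto
  also have "\<dots> \<le> v \<bullet> damped_laplacian E R K \<gamma> v"
    using assms(1) by (rule damped_laplacian_coercive)
  also have "\<dots> \<le> norm v * norm (damped_laplacian E R K \<gamma> v)"
    by (rule norm_cauchy_schwarz)
  finally have "m * norm v \<le> norm (damped_laplacian E R K \<gamma> v)" if "v \<noteq> 0"
    using that by (simp add: mult.left_commute[of m] mult_le_cancel_left)
  then show ?thesis
    using assms(2) by (cases "v = 0") (auto simp: field_simps)
qed

lemma damped_laplacian_solvable:
  assumes "\<gamma> > 0" and "m > 0" and "\<And>i. m \<le> K $ i"
  obtains v where "damped_laplacian E R K \<gamma> v = r"
  using linear_kernel_0_solvable[OF linear_damped_laplacian]
    damped_laplacian_norm_bound[OF assms] by (metis div_0 norm_le_zero_iff norm_zero)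

text \<open>The curve \<open>y \<gamma> = c 1 + \<gamma> w\<close> solves the equation up to an error \<open>\<gamma> d\<close>: at the singular order
  \<open>1 / \<gamma>\<close> the constant vector drops out, and at order \<open>1\<close> the vector \<open>w\<close> is chosen to produce the
  missing part of \<open>b\<close>. The uniform bound on the inverse turns the error in the equation into
  the error \<open>O(\<gamma>)\<close> in the solution.\<close>

lemma damped_equilibrium_tendsto_consensus:
  assumes m: "m > 0" "\<And>i. m \<le> K $ i"
    and x: "\<And>\<gamma>. \<gamma> > 0 \<Longrightarrow> damped_laplacian E R K \<gamma> (x \<gamma>) = b"
    and c: "c * (\<Sum>i\<in>UNIV. K $ i) = (\<Sum>i\<in>UNIV. b $ i)"
  shows "(x \<longlongrightarrow> (\<chi> i. c)) (at_right 0)"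
proof -
  have "(\<Sum>i\<in>UNIV. (b - c *\<^sub>R K) $ i) = 0"
    using c by (simp add: sum_subtractf sum_distrib_left)
  then obtain w where w: "laplacian E R *v w = b - c *\<^sub>R K"
    by (rule laplacian_solvable)
  define d where "d = (\<chi> i. K $ i * w $ i)"
  define y where "y \<gamma> = (\<chi> i. c) + \<gamma> *\<^sub>R w" for \<gamma> :: real
  have bound: "norm (x \<gamma> - y \<gamma>) \<le> \<gamma> * (norm d / m)" if "\<gamma> > 0" for \<gamma>
  proof -
    have "damped_laplacian E R K \<gamma> (y \<gamma>) = b + \<gamma> *\<^sub>R d"
      using that
      by (simp add: damped_laplacian_def y_def d_def matrix_vector_right_distrib
          matrix_vector_mult_scaleR laplacian_const w vec_eq_iff algebra_simps)
    then have "damped_laplacian E R K \<gamma> (x \<gamma> - y \<gamma>) = - (\<gamma> *\<^sub>R d)"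
      using that x by (simp add: linear_diff[OF linear_damped_laplacian])
    then show ?thesis
      using damped_laplacian_norm_bound[OF that m, of "x \<gamma> - y \<gamma>"] that by simp
  qed
  have "((\<lambda>\<gamma>. x \<gamma> - y \<gamma>) \<longlongrightarrow> 0) (at_right 0)"
  proof (rule Lim_null_comparison)
    show "\<forall>\<^sub>F \<gamma> in at_right 0. norm (x \<gamma> - y \<gamma>) \<le> \<gamma> * (norm d / m)"
      using bound by (auto simp: eventually_at_right_less eventually_at_filter)
    show "((\<lambda>\<gamma>. \<gamma> * (norm d / m)) \<longlongrightarrow> 0) (at_right 0)"
      by (intro tendsto_eq_intros refl) auto
  qed
  moreover have "(y \<longlongrightarrow> (\<chi> i. c)) (at_right 0)"
    unfolding y_def by (intro tendsto_eq_intros refl) auto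
  ultimately have "((\<lambda>\<gamma>. (x \<gamma> - y \<gamma>) + y \<gamma>) \<longlongrightarrow> 0 + (\<chi> i. c)) (at_right 0)"
    by (rule tendsto_add)
  then show ?thesis by simp
qed

section \<open>Optimal current injections\<close>

text \<open>By the description of the range of the Laplacian, the constraint on \<open>u\<close> is
  \<open>\<Sum> (Iinj + u) = 0\<close> for every \<open>\<gamma>\<close>. The gradient of the cost at \<open>- c K\<close> is the constant
  vector \<open>- c\<close>, orthogonal to all feasible directions, so the cost of a feasible \<open>u\<close> exceeds the cost of
  \<open>- c K\<close> by the cost of the difference, which is positive unless \<open>u = - c K\<close>.\<close>

lemma optimal_injection_iff:
  assumes K: "\<And>i. K $ i > 0" and "\<gamma> > 0"
    and c: "c * (\<Sum>i\<in>UNIV. K $ i) = (\<Sum>i\<in>UNIV. Iinj $ i)"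
  shows "optimal_injection E R \<gamma> (\<chi> i. 1 / K $ i) Iinj u \<longleftrightarrow> u = - (c *\<^sub>R K)"
proof -
  let ?cost = "\<lambda>u. \<Sum>i\<in>UNIV. 1 / 2 * (1 / K $ i) * (u $ i)\<^sup>2"
  let ?us = "- (c *\<^sub>R K)"
  have feasible: "(\<exists>Vs. (1 / \<gamma>) *\<^sub>R (laplacian E R *v Vs) = Iinj + u)
      \<longleftrightarrow> (\<Sum>i\<in>UNIV. Iinj $ i + u $ i) = 0" for u
  proof
    assume "\<exists>Vs. (1 / \<gamma>) *\<^sub>R (laplacian E R *v Vs) = Iinj + u"
    then obtain Vs where "(1 / \<gamma>) *\<^sub>R (laplacian E R *v Vs) = Iinj + u" ..
    then have "(\<Sum>i\<in>UNIV. Iinj $ i + u $ i) = (\<Sum>i\<in>UNIV. (1 / \<gamma>) * (laplacian E R *v Vs) $ i)"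
      by (metis vector_add_component vector_scaleR_component real_scaleR_def)
    then show "(\<Sum>i\<in>UNIV. Iinj $ i + u $ i) = 0"
      by (simp only: sum_distrib_left[symmetric] laplacian_sum_eq_0 mult_zero_right)
  next
    assume "(\<Sum>i\<in>UNIV. Iinj $ i + u $ i) = 0"
    then obtain w where "laplacian E R *v w = Iinj + u"
      using laplacian_solvable[of "Iinj + u"] by auto
    then have "(1 / \<gamma>) *\<^sub>R (laplacian E R *v (\<gamma> *\<^sub>R w)) = Iinj + u"
      using \<open>\<gamma> > 0\<close> by (simp add: matrix_vector_mult_scaleR)
    then show "\<exists>Vs. (1 / \<gamma>) *\<^sub>R (laplacian E R *v Vs) = Iinj + u" ..
  qed
  have us_feasible: "(\<Sum>i\<in>UNIV. Iinj $ i + ?us $ i) = 0"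
    using c by (simp add: sum_subtractf sum_distrib_left)
  have cost: "?cost u = ?cost ?us + ?cost (u - ?us)"
    if u: "(\<Sum>i\<in>UNIV. Iinj $ i + u $ i) = 0" for u
  proof -
    have "?cost u - ?cost ?us - ?cost (u - ?us) = (\<Sum>i\<in>UNIV. - c * (u $ i - ?us $ i))"
      unfolding sum_subtractf[symmetric]
      by (intro sum.cong refl) (use K in \<open>simp add: field_simps power2_eq_square less_imp_neq[symmetric]\<close>)
    also have "\<dots> = - c * ((\<Sum>i\<in>UNIV. Iinj $ i + u $ i) - (\<Sum>i\<in>UNIV. Iinj $ i + ?us $ i))"
      by (simp only: sum_distrib_left[symmetric] sum_subtractf[symmetric]) simp
    also have "\<dots> = 0"
      using u us_feasible by simp
    finally show ?thesis by simp
  qed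
  have cost_nonneg: "?cost d \<ge> 0" for d
    using K by (intro sum_nonneg) (simp add: less_imp_le)
  have cost_pos: "?cost d > 0" if d: "d \<noteq> 0" for d
  proof -
    obtain k where "d $ k \<noteq> 0"
      using d by (auto simp: vec_eq_iff)
    then show ?thesis
      using K by (intro sum_pos2[of _ k]) (simp_all add: less_imp_le)
  qed
  have "optimal_injection E R \<gamma> (\<chi> i. 1 / K $ i) Iinj u \<longleftrightarrow>
      (\<Sum>i\<in>UNIV. Iinj $ i + u $ i) = 0 \<and>
      (\<forall>u'. (\<Sum>i\<in>UNIV. Iinj $ i + u' $ i) = 0 \<longrightarrow> ?cost u \<le> ?cost u')" for u
    unfolding feasible[symmetric]
    by (auto simp: optimal_injection_def is_arg_min_def not_less)
  moreover have "(\<Sum>i\<in>UNIV. Iinj $ i + u $ i) = 0 \<and>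
      (\<forall>u'. (\<Sum>i\<in>UNIV. Iinj $ i + u' $ i) = 0 \<longrightarrow> ?cost u \<le> ?cost u') \<longleftrightarrow> u = ?us"
    (is "?feas \<and> ?min \<longleftrightarrow> _")
  proof
    assume *: "?feas \<and> ?min"
    then have "?cost u \<le> ?cost ?us"
      using us_feasible by blast
    then have "?cost (u - ?us) \<le> 0"
      using cost[of u] * by linarith
    then show "u = ?us"
      using cost_pos[of "u - ?us"] by (meson not_le right_minus_eq)
  next
    assume u: "u = ?us"
    have "?cost ?us \<le> ?cost u'" if "(\<Sum>i\<in>UNIV. Iinj $ i + u' $ i) = 0" for u'
      using cost[OF that] cost_nonneg[of "u' - ?us"] by linarith
    then show "?feas \<and> ?min"
      using us_feasible u by blast
  qed
  ultimately show ?thesis by blast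
qed

end

section \<open>Closed-loop trajectories\<close>

lemma integrator_idle_in_deadband:
  assumes "deadband_integrator Vlo Vhi V z" and "z 0 = 0" and "t \<ge> 0"
    and "\<And>s i. 0 \<le> s \<Longrightarrow> s \<le> t \<Longrightarrow> Vlo $ i \<le> V s $ i \<and> V s $ i \<le> Vhi $ i"
  shows "z t = 0"
proof -
  have deriv: "((\<lambda>s. z s $ i) has_real_derivative 0) (at s within {0..})"
    if "0 \<le> s" "s \<le> t" for s i
  proof -
    have "pos_part (V s $ i - Vhi $ i) - pos_part (Vlo $ i - V s $ i) = 0"
      using assms(4)[of s i] that by (simp add: pos_part_def)
    then show ?thesis
      using assms(1) that unfolding deadband_integrator_def by metis
  qed
  have "((\<lambda>s. z s $ i) has_real_derivative 0) (at s within {0..t})" if "0 \<le> s" "s \<le> t" for s i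
    using deriv[OF that] by (rule DERIV_subset) auto
  then have "z t $ i = z 0 $ i" for i
    using has_field_derivative_zero_constant[of "{0..t}" "\<lambda>s. z s $ i"] \<open>t \<ge> 0\<close> by fastforce
  then show ?thesis
    using assms(2) by (simp add: vec_eq_iff)
qed

context resistive_network
begin

text \<open>The nominal voltages keep a margin \<open>\<rho>\<close> from the voltage limits. Half of it is allotted to the equilibrium
  deviation \<open>x\<close>, and half to the distance \<open>e\<close> from equilibrium, which the energy level
  \<open>c * (\<rho> / 2)\<^sup>2\<close> controls. The energy is weighted with \<open>C\<close> so that its derivative along the
  trajectory is \<open>- 2 * (e \<bullet> damped_laplacian E R KP \<gamma> e)\<close> while the integrators are at rest.\<close>

lemma closed_loop_settles_in_deadband:
  assumes C: "\<And>i. 0 < c \<and> c \<le> C $ i \<and> C $ i \<le> c'" and K: "\<And>i. KP $ i > 0"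
    and \<gamma>: "\<gamma> > 0"
    and nom: "\<And>i j. Vnom $ i = Vnom $ j"
    and margin: "\<And>i. Vlo $ i \<le> Vnom $ i - \<rho> \<and> Vnom $ i + \<rho> \<le> Vhi $ i"
    and sol: "closed_loop_solution E R C KP KI Vnom Vlo Vhi \<gamma> Iinj V z" and z0: "z 0 = 0"
    and eq: "damped_laplacian E R KP \<gamma> x = Iinj"
    and small_x: "norm x \<le> \<rho> / 2"
    and "\<rho> > 0"
    and init: "c' * (norm (V 0 - Vnom - x))\<^sup>2 < c * (\<rho> / 2)\<^sup>2"
  shows "((\<lambda>t. pi_control KP KI Vnom (V t) (z t)) \<longlongrightarrow> (\<chi> i. - KP $ i * x $ i)) at_top"
proof -
  define e where "e t = V t - Vnom - x" for t
  define S where "S t = (\<Sum>i\<in>UNIV. C $ i * (e t $ i)\<^sup>2)" for t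
  \<comment> \<open>the total current into terminal \<open>i\<close>; the equal nominal voltages make it an expression in
    \<open>V - Vnom\<close>\<close>
  define F where "F t i = Iinj $ i - damped_laplacian E R KP \<gamma> (V t - Vnom) $ i - KI $ i * z t $ i" for t i
  define D where "D t = (\<Sum>i\<in>UNIV. 2 * e t $ i * F t i)" for t
  have Cpos: "C $ i > 0" "c > 0" for i
    using C[of i] by auto
  have V_deriv: "((\<lambda>s. V s $ i) has_real_derivative F t i / C $ i) (at t within {0..})"
    if "t \<ge> 0" for t i
  proof -
    have "(\<Sum>j\<in>nbrs E i. 1 / (\<gamma> * R i j) * (V t $ i - V t $ j))
        = 1 / \<gamma> * (laplacian E R *v (V t - Vnom)) $ i"
      unfolding laplacian_component sum_distrib_left
    proof (intro sum.cong refl)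
      fix j
      show "1 / (\<gamma> * R i j) * (V t $ i - V t $ j)
          = 1 / \<gamma> * (((V t - Vnom) $ i - (V t - Vnom) $ j) / R i j)"
        using nom[of i j] by simp
    qed
    then have "- (\<Sum>j\<in>nbrs E i. 1 / (\<gamma> * R i j) * (V t $ i - V t $ j)) + Iinj $ i
        + pi_control KP KI Vnom (V t) (z t) $ i = F t i"
      by (simp add: F_def damped_laplacian_def pi_control_def)
    then show ?thesis
      using sol that
      by (simp only: closed_loop_solution_def mtdc_dynamics_def flip: \<open>_ = F t i\<close>)
  qed
  have S_deriv: "(S has_real_derivative D t) (at t within {0..})" if "t \<ge> 0" for t
    unfolding S_def D_def e_def
    using Cpos that
    by (auto intro!: derivative_eq_intros V_deriv sum.cong simp: less_imp_neq[symmetric])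
  have norm_e: "c * (norm (e t))\<^sup>2 \<le> S t" "S t \<le> c' * (norm (e t))\<^sup>2" for t
  proof -
    have *: "(norm (e t))\<^sup>2 = (\<Sum>i\<in>UNIV. (e t $ i)\<^sup>2)"
      unfolding power2_norm_eq_inner by (simp add: inner_vec_def power2_eq_square)
    show "c * (norm (e t))\<^sup>2 \<le> S t" "S t \<le> c' * (norm (e t))\<^sup>2"
      unfolding S_def * sum_distrib_left
      using C by (auto intro!: sum_mono mult_right_mono)
  qed
  define b where "b = c * (\<rho> / 2)\<^sup>2"
  have in_deadband: "Vlo $ i \<le> V t $ i \<and> V t $ i \<le> Vhi $ i" if "S t < b" for t i
  proof -
    have "c * (norm (e t))\<^sup>2 < c * (\<rho> / 2)\<^sup>2"
      using that norm_e(1)[of t] by (simp add: b_def)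
    then have "norm (e t) < \<rho> / 2"
      using Cpos \<open>\<rho> > 0\<close> power_less_imp_less_base[of "norm (e t)" 2 "\<rho> / 2"] by simp
    moreover have "\<bar>e t $ i\<bar> \<le> norm (e t)" "\<bar>x $ i\<bar> \<le> norm x"
      by (rule component_le_norm_cart)+
    moreover have "e t $ i = V t $ i - Vnom $ i - x $ i"
      by (simp add: e_def)
    ultimately show ?thesis
      using small_x margin[of i] by linarith
  qed
  have idle: "z t = 0" if "t \<ge> 0" "\<And>s. 0 \<le> s \<Longrightarrow> s \<le> t \<Longrightarrow> S s < b" for t
    using integrator_idle_in_deadband[of Vlo Vhi V z t] sol z0 in_deadband that
    by (simp add: closed_loop_solution_def)
  obtain a where a: "a > 0" "\<And>i. a \<le> KP $ i / C $ i"
    by (rule pos_lower_bound_finite[of "\<lambda>i. KP $ i / C $ i"]) (auto simp: K Cpos)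
  have decay: "D t \<le> - (2 * a) * S t"
    if "t \<ge> 0" "\<And>s. 0 \<le> s \<Longrightarrow> s \<le> t \<Longrightarrow> S s < b" for t
  proof -
    have "V t - Vnom = e t + x" by (simp add: e_def)
    then have "F t i = - damped_laplacian E R KP \<gamma> (e t) $ i" for i
      using idle[OF that] eq by (simp add: F_def linear_add[OF linear_damped_laplacian])
    then have "D t = - 2 * (e t \<bullet> damped_laplacian E R KP \<gamma> (e t))"
      by (simp add: D_def inner_vec_def sum_distrib_left sum_negf mult.assoc)
    also have "\<dots> \<le> - 2 * (\<Sum>i\<in>UNIV. KP $ i * (e t $ i)\<^sup>2)"
      using damped_laplacian_coercive[OF \<gamma>] by simp
    also have "\<dots> \<le> - 2 * (\<Sum>i\<in>UNIV. a * C $ i * (e t $ i)\<^sup>2)"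
    proof -
      have "a * C $ i \<le> KP $ i" for i
        using a(2)[of i] Cpos(1)[of i] by (simp add: pos_le_divide_eq)
      then have "(\<Sum>i\<in>UNIV. a * C $ i * (e t $ i)\<^sup>2) \<le> (\<Sum>i\<in>UNIV. KP $ i * (e t $ i)\<^sup>2)"
        by (intro sum_mono mult_right_mono) auto
      then show ?thesis by simp
    qed
    also have "\<dots> = - (2 * a) * S t"
      by (simp add: S_def sum_distrib_left mult.assoc)
    finally show ?thesis .
  qed
  have S_nonneg: "S t \<ge> 0" for t
    unfolding S_def using Cpos by (intro sum_nonneg) (simp add: less_imp_le)
  have S0: "S 0 < b"
    using norm_e(2)[of 0] init by (simp add: b_def e_def)
  have "0 \<le> 2 * a" using a by simp
  note barrier = barrier_exponential_decay[OF S_deriv S_nonneg this S0 decay]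
  have "(S \<longlongrightarrow> 0) at_top"
  proof (rule tendsto_sandwich[OF _ _ tendsto_const])
    show "\<forall>\<^sub>F t in at_top. S t \<le> S 0 * exp (- (2 * a) * t)"
      using eventually_ge_at_top[of 0] by eventually_elim (rule barrier(2))
    have "filterlim (\<lambda>t. 2 * a * t) at_top at_top"
      using a by (intro filterlim_tendsto_pos_mult_at_top[OF tendsto_const _ filterlim_ident]) simp
    then have "((\<lambda>t. exp (- (2 * a * t))) \<longlongrightarrow> 0) at_top"
      by (intro filterlim_compose[OF exp_at_bot] filterlim_compose[OF filterlim_uminus_at_bot_at_top])
    then show "((\<lambda>t. S 0 * exp (- (2 * a) * t)) \<longlongrightarrow> 0) at_top"
      using tendsto_mult_right_zero by fastforce
  qed (use S_nonneg in auto)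
  then have "((\<lambda>t. sqrt (S t / c)) \<longlongrightarrow> sqrt (0 / c)) at_top"
    using Cpos by (intro tendsto_intros) auto
  moreover have "norm (e t) \<le> sqrt (S t / c)" for t
    using norm_e(1)[of t] Cpos by (intro real_le_rsqrt) (simp add: pos_le_divide_eq mult.commute)
  ultimately have e_lim: "(e \<longlongrightarrow> 0) at_top"
    by (intro Lim_null_comparison[of e "\<lambda>t. sqrt (S t / c)"]) simp_all
  have "((\<lambda>t. (\<chi> i. - KP $ i * (e t $ i + x $ i))) \<longlongrightarrow> (\<chi> i. - KP $ i * x $ i)) at_top"
  proof (rule tendsto_vec_lambda)
    fix i
    have "((\<lambda>t. e t $ i + x $ i) \<longlongrightarrow> 0 $ i + x $ i) at_top"
      by (rule tendsto_add[OF tendsto_vec_nth[OF e_lim] tendsto_const])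
    then show "((\<lambda>t. - KP $ i * (e t $ i + x $ i)) \<longlongrightarrow> - KP $ i * x $ i) at_top"
      using tendsto_mult_left by fastforce
  qed
  moreover have "\<forall>\<^sub>F t in at_top. (\<chi> i. - KP $ i * (e t $ i + x $ i))
      = pi_control KP KI Vnom (V t) (z t)"
    using eventually_ge_at_top[of 0]
  proof eventually_elim
    case (elim t)
    have "z t = 0"
      using elim by (rule idle) (rule barrier(1))
    then show ?case
      by (simp add: pi_control_def e_def)
  qed
  ultimately show ?thesis
    by (rule Lim_transform_eventually)
qed

end

section \<open>Current sharing\<close>

theorem lemma7:
  fixes E :: "('n::finite \<times> 'n) set"
    and R :: "'n \<Rightarrow> 'n \<Rightarrow> real"
    and C KP KI Vnom Vlo Vhi :: "real ^ 'n"
  assumes "connected_graph E"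
    and "\<And>i j. (i, j) \<in> E \<Longrightarrow> R i j > 0 \<and> R i j = R j i"
    and "\<And>i. C $ i > 0"
    and "\<And>i. KP $ i > 0"
    and "\<And>i. KI $ i > 0"
    and "\<And>i j. Vnom $ i = Vnom $ j"
    and "\<And>i. Vlo $ i < Vnom $ i \<and> Vnom $ i < Vhi $ i"
  shows "\<exists>\<delta>>0. \<forall>Iinj :: real ^ 'n. norm Iinj < \<delta> \<longrightarrow>
    (\<exists>us. (\<forall>\<gamma>>0. \<forall>u. optimal_injection E R \<gamma> (\<chi> i. 1 / KP $ i) Iinj u \<longleftrightarrow> u = us) \<and>
      (\<forall>V z :: real \<Rightarrow> real \<Rightarrow> real ^ 'n.
        (\<forall>\<gamma>>0. closed_loop_solution E R C KP KI Vnom Vlo Vhi \<gamma> Iinj (V \<gamma>) (z \<gamma>) \<and>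
                norm (V \<gamma> 0 - Vnom) < \<delta> \<and> z \<gamma> 0 = 0) \<longrightarrow>
        (\<exists>U. (\<forall>\<gamma>>0. ((\<lambda>t. pi_control KP KI Vnom (V \<gamma> t) (z \<gamma> t)) \<longlongrightarrow> U \<gamma>) at_top) \<and>
             (U \<longlongrightarrow> us) (at_right 0))))"
proof -
  interpret resistive_network E R
    using assms(1,2) by (rule resistive_network.intro)
  obtain m where m: "m > 0" "\<And>i. m \<le> KP $ i"
    using pos_lower_bound_finite[of "\<lambda>i. KP $ i", OF assms(4)] by blast
  obtain c where c: "c > 0" "\<And>i. c \<le> C $ i"
    using pos_lower_bound_finite[of "\<lambda>i. C $ i", OF assms(3)] by blast
  define c' where "c' = Max (range (\<lambda>i. C $ i))"
  have c': "C $ i \<le> c'" for i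
    by (simp add: c'_def)
  have cc': "c \<le> c'" "c' > 0"
    using c(1) c(2)[of undefined] c'[of undefined] by linarith+
  obtain \<rho> where \<rho>: "\<rho> > 0" "\<And>i. \<rho> \<le> min (Vnom $ i - Vlo $ i) (Vhi $ i - Vnom $ i)"
    by (rule pos_lower_bound_finite[of "\<lambda>i. min (Vnom $ i - Vlo $ i) (Vhi $ i - Vnom $ i)"])
       (use assms(7) in auto)
  then have margin: "Vlo $ i \<le> Vnom $ i - \<rho> \<and> Vnom $ i + \<rho> \<le> Vhi $ i" for i
    using \<rho>(2)[of i] by linarith
  \<comment> \<open>the energy weights lie between \<open>c\<close> and \<open>c'\<close>, so an initial distance below \<open>q * (\<rho> / 2)\<close> from
    equilibrium keeps the later distances below \<open>\<rho> / 2\<close>\<close>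
  define q where "q = sqrt (c / c')"
  have q: "q > 0" "q \<le> 1" "c' * q\<^sup>2 = c"
    using c cc' by (auto simp: q_def)
  \<comment> \<open>\<open>\<delta>\<close> bounds the initial deviation and \<open>\<delta> / m\<close> the equilibrium deviation; together they must not
    exceed \<open>q * (\<rho> / 2)\<close>\<close>
  define l where "l = 1 + 1 / m"
  have "l > 0"
    using m by (simp add: l_def add_pos_pos)
  define \<delta> where "\<delta> = q * (\<rho> / 2) / l"
  have "\<delta> > 0"
    using q \<rho> \<open>l > 0\<close> by (simp add: \<delta>_def)
  have \<delta>: "\<delta> + \<delta> / m = q * (\<rho> / 2)"
  proof -
    have "\<delta> + \<delta> / m = \<delta> * l"
      by (simp add: l_def algebra_simps)
    then show ?thesis
      using \<open>l > 0\<close> by (simp add: \<delta>_def)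
  qed
  show ?thesis
  proof (intro exI[of _ \<delta>] conjI allI impI \<open>\<delta> > 0\<close>)
    fix Iinj :: "real ^ 'n" assume I: "norm Iinj < \<delta>"
    define k where "k = (\<Sum>i\<in>UNIV. Iinj $ i) / (\<Sum>i\<in>UNIV. KP $ i)"
    have "(\<Sum>i\<in>UNIV. KP $ i) > 0"
      using assms(4) by (intro sum_pos) auto
    then have k: "k * (\<Sum>i\<in>UNIV. KP $ i) = (\<Sum>i\<in>UNIV. Iinj $ i)"
      by (simp add: k_def)
    have "\<forall>\<gamma>>0. \<exists>x. damped_laplacian E R KP \<gamma> x = Iinj"
      using damped_laplacian_solvable[OF _ m] by metis
    then obtain x where x: "\<And>\<gamma>. \<gamma> > 0 \<Longrightarrow> damped_laplacian E R KP \<gamma> (x \<gamma>) = Iinj"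
      by metis
    have norm_x: "norm (x \<gamma>) < \<delta> / m" if "\<gamma> > 0" for \<gamma>
    proof -
      have "norm (x \<gamma>) \<le> norm Iinj / m"
        using damped_laplacian_norm_bound[OF that m, of "x \<gamma>"] x[OF that] by simp
      also have "\<dots> < \<delta> / m"
        using I m by (simp add: divide_strict_right_mono)
      finally show ?thesis .
    qed
    show "\<exists>us. (\<forall>\<gamma>>0. \<forall>u. optimal_injection E R \<gamma> (\<chi> i. 1 / KP $ i) Iinj u \<longleftrightarrow> u = us) \<and>
      (\<forall>V z :: real \<Rightarrow> real \<Rightarrow> real ^ 'n.
        (\<forall>\<gamma>>0. closed_loop_solution E R C KP KI Vnom Vlo Vhi \<gamma> Iinj (V \<gamma>) (z \<gamma>) \<and>
                norm (V \<gamma> 0 - Vnom) < \<delta> \<and> z \<gamma> 0 = 0) \<longrightarrow>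
        (\<exists>U. (\<forall>\<gamma>>0. ((\<lambda>t. pi_control KP KI Vnom (V \<gamma> t) (z \<gamma> t)) \<longlongrightarrow> U \<gamma>) at_top) \<and>
             (U \<longlongrightarrow> us) (at_right 0)))"
    proof (intro exI[of _ "- (k *\<^sub>R KP)"] conjI allI impI)
      show "optimal_injection E R \<gamma> (\<chi> i. 1 / KP $ i) Iinj u \<longleftrightarrow> u = - (k *\<^sub>R KP)"
        if "\<gamma> > 0" for \<gamma> u
        using assms(4) that k by (rule optimal_injection_iff)
    next
      fix V z :: "real \<Rightarrow> real \<Rightarrow> real ^ 'n"
      assume sol: "\<forall>\<gamma>>0. closed_loop_solution E R C KP KI Vnom Vlo Vhi \<gamma> Iinj (V \<gamma>) (z \<gamma>) \<and>
                norm (V \<gamma> 0 - Vnom) < \<delta> \<and> z \<gamma> 0 = 0"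
      show "\<exists>U. (\<forall>\<gamma>>0. ((\<lambda>t. pi_control KP KI Vnom (V \<gamma> t) (z \<gamma> t)) \<longlongrightarrow> U \<gamma>) at_top) \<and>
             (U \<longlongrightarrow> - (k *\<^sub>R KP)) (at_right 0)"
      proof (intro exI[of _ "\<lambda>\<gamma>. \<chi> i. - KP $ i * x \<gamma> $ i"] conjI allI impI)
        fix \<gamma> :: real assume \<gamma>: "\<gamma> > 0"
        have "norm (V \<gamma> 0 - Vnom - x \<gamma>) \<le> norm (V \<gamma> 0 - Vnom) + norm (x \<gamma>)"
          by (rule norm_triangle_ineq4)
        also have "\<dots> < q * (\<rho> / 2)"
          using sol \<gamma> norm_x[OF \<gamma>] \<delta> by (smt (verit))
        finally have "(norm (V \<gamma> 0 - Vnom - x \<gamma>))\<^sup>2 < (q * (\<rho> / 2))\<^sup>2"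
          by (intro power_strict_mono) auto
        then have init: "c' * (norm (V \<gamma> 0 - Vnom - x \<gamma>))\<^sup>2 < c * (\<rho> / 2)\<^sup>2"
          using cc' unfolding q(3)[symmetric] power_mult_distrib[of q] by (simp add: mult.assoc)
        have "q * (\<rho> / 2) \<le> 1 * (\<rho> / 2)"
          using q \<rho> by (intro mult_right_mono) auto
        then have small_x: "norm (x \<gamma>) \<le> \<rho> / 2"
          using norm_x[OF \<gamma>] \<delta> \<open>\<delta> > 0\<close> by linarith
        show "((\<lambda>t. pi_control KP KI Vnom (V \<gamma> t) (z \<gamma> t)) \<longlongrightarrow> (\<chi> i. - KP $ i * x \<gamma> $ i)) at_top"
          by (rule closed_loop_settles_in_deadband[of c C c' KP \<gamma> Vnom Vlo \<rho> Vhi KI Iinj "V \<gamma>" "z \<gamma>"])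
             (use c c' assms(4,6) margin sol \<gamma> x small_x \<rho> init in auto)
      next
        have "(x \<longlongrightarrow> (\<chi> i. k)) (at_right 0)"
          using m x k by (rule damped_equilibrium_tendsto_consensus)
        then have "((\<lambda>\<gamma>. \<chi> i. - KP $ i * x \<gamma> $ i) \<longlongrightarrow> (\<chi> i. - KP $ i * (\<chi> i. k) $ i)) (at_right 0)"
          by (intro tendsto_vec_lambda tendsto_intros)
        moreover have "(\<chi> i. - KP $ i * (\<chi> i. k) $ i) = - (k *\<^sub>R KP)"
          by (simp add: vec_eq_iff)
        ultimately show "((\<lambda>\<gamma>. \<chi> i. - KP $ i * x \<gamma> $ i) \<longlongrightarrow> - (k *\<^sub>R KP)) (at_right 0)"
          by simp
      qed
    qed
  qed
qed

end
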